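(* Let $V$ be a $k$-vector space and let $\varphi\colon V\to V$ be a $k$-linear endomorphism, with localization morphism $\phi\colon V\to V_x$. The following statements are equivalent: \begin{itemize} \item[I)] $\varphi$ is a core-nilpotent endomorphism. \item[II)] The morphism $\phi\colon V\to V_x$ admits a (unique) section of $k[x]$-modules, i.e. a $k[x]$-linear map $\sigma\colon V_x\to V$ with $\phi\circ\sigma=\operatorname{Id}_{V_x}$, and $\varphi_{|\operatorname{Ker}(\phi)}$ is nilpotent. \item[III)] There is a (unique) decomposition $V=U\oplus W$ into $\varphi$-invariant subspaces with $\varphi_{|U}$ nilpotent and $\varphi_{|W}\colon W\to W$ an isomorphism. \item[IV)] There is a (unique) decomposition $\varphi=\varphi_1+\varphi_2$ with $\varphi_1,\varphi_2\in\operatorname{End}_k(V)$, $\varphi_2$ nilpotent, $i(\varphi_1)\le 1$, and $\varphi_1\circ\varphi_2=0=\varphi_2\circ\varphi_1$. \item[V)] $\varphi$ admits a (unique) Drazin inverse. \end{itemize}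
   Context: $k$ is a field and $V$ is an arbitrary (possibly infinite-dimensional) $k$-vector space. The endomorphism $\varphi$ makes $V$ a $k[x]$-module via $x\cdot v:=\varphi(v)$. $V_x$ denotes the localization of $V$ at the multiplicative system $S_x=\{1,x,x^2,\dots\}$, and $\phi\colon V\to V_x$, $v\mapsto v/1$, is the localization morphism. The index $i(f)$ of $f\in\operatorname{End}_k(V)$ is $0$ if $f$ is an automorphism; otherwise it is the smallest positive integer $m$ (if one exists) such that $\operatorname{Ker}(f^m)=\operatorname{Ker}(f^{m+1})$ and $\operatorname{Im}(f^m)=\operatorname{Im}(f^{m+1})$; "$i(f)\le 1$" means that the index exists and is at most $1$. An endomorphism $\varphi$ is core-nilpotent when there exist $\varphi_1,\varphi_2\in\operatorname{End}_k(V)$ with $\varphi=\varphi_1+\varphi_2$, $i(\varphi_1)\le 1$, $\varphi_2$ nilpotent, and $\varphi_1\circ\varphi_2=0=\varphi_2\circ\varphi_1$. A Drazin inverse of $\varphi$ is an endomorphism $\varphi^D$ of $V$ satisfying $\varphi^D\circ\varphi\circ\varphi^D=\varphi^D$, $\varphi^D\circ\varphi=\varphi\circ\varphi^D$ and $\varphi^{m+1}\circ\varphi^D=\varphi^m$ for $m=i(\varphi)$ (in particular the index of $\varphi$ exists). The parenthetical "(unique)" means that the object in question, when it exists, is unique. *)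

theory Defs
  imports "HOL-Computational_Algebra.Polynomial" "HOL-Library.Extended_Nat"
begin

section \<open>Endomorphisms of a vector space\<close>

definition nilpotent_on :: "('b \<Rightarrow> 'b) \<Rightarrow> 'b::zero set \<Rightarrow> bool" where
  "nilpotent_on f U \<longleftrightarrow> (\<exists>n. \<forall>u\<in>U. (f ^^ n) u = 0)"

text \<open>The value \<open>\<infinity>\<close> (the infimum of the empty set) encodes that the index does not exist.\<close>

definition endo_index :: "('b::zero \<Rightarrow> 'b) \<Rightarrow> enat" where
  "endo_index f = (if bij f then 0 else
     (INF m \<in> {m. 0 < m \<and> {v. (f ^^ m) v = 0} = {v. (f ^^ (m + 1)) v = 0}
                       \<and> range (f ^^ m) = range (f ^^ (m + 1))}. enat m))"

definition core_nilpotent_decomposition ::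
  "('a::field \<Rightarrow> 'b::ab_group_add \<Rightarrow> 'b) \<Rightarrow> ('b \<Rightarrow> 'b) \<Rightarrow> ('b \<Rightarrow> 'b) \<Rightarrow> ('b \<Rightarrow> 'b) \<Rightarrow> bool" where
  "core_nilpotent_decomposition scale f f1 f2 \<longleftrightarrow>
     Vector_Spaces.linear scale scale f1 \<and> Vector_Spaces.linear scale scale f2 \<and>
     f = (\<lambda>v. f1 v + f2 v) \<and>
     endo_index f1 \<le> 1 \<and> nilpotent_on f2 UNIV \<and>
     f1 \<circ> f2 = (\<lambda>_. 0) \<and> f2 \<circ> f1 = (\<lambda>_. 0)"

definition core_nilpotent ::
  "('a::field \<Rightarrow> 'b::ab_group_add \<Rightarrow> 'b) \<Rightarrow> ('b \<Rightarrow> 'b) \<Rightarrow> bool" where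
  "core_nilpotent scale f \<longleftrightarrow> (\<exists>f1 f2. core_nilpotent_decomposition scale f f1 f2)"

definition nilpotent_iso_decomposition ::
  "('a::field \<Rightarrow> 'b::ab_group_add \<Rightarrow> 'b) \<Rightarrow> ('b \<Rightarrow> 'b) \<Rightarrow> 'b set \<Rightarrow> 'b set \<Rightarrow> bool" where
  "nilpotent_iso_decomposition scale f U W \<longleftrightarrow>
     module.subspace scale U \<and> module.subspace scale W \<and>
     U \<inter> W = {0} \<and> {u + w | u w. u \<in> U \<and> w \<in> W} = UNIV \<and>
     f ` U \<subseteq> U \<and> f ` W \<subseteq> W \<and>
     nilpotent_on f U \<and> bij_betw f W W"

definition drazin_inverse ::
  "('a::field \<Rightarrow> 'b::ab_group_add \<Rightarrow> 'b) \<Rightarrow> ('b \<Rightarrow> 'b) \<Rightarrow> ('b \<Rightarrow> 'b) \<Rightarrow> bool" where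
  "drazin_inverse scale f d \<longleftrightarrow>
     Vector_Spaces.linear scale scale d \<and>
     d \<circ> f \<circ> d = d \<and> d \<circ> f = f \<circ> d \<and>
     (\<exists>m. endo_index f = enat m \<and> (f ^^ (m + 1)) \<circ> d = f ^^ m)"

section \<open>Localization of a module\<close>

text \<open>
  The localization of a module at a multiplicative system \<open>S\<close> is a set of equivalence classes of
  pairs \<open>(v, s)\<close> with \<open>s \<in> S\<close>. Since \<open>S\<close> and the module structure are terms, it is a carrier
  set rather than a type, and maps out of it are considered only on this carrier.
\<close>

definition loc_rel ::
  "('r::comm_ring_1 \<Rightarrow> 'b::ab_group_add \<Rightarrow> 'b) \<Rightarrow> 'r set \<Rightarrow> (('b \<times> 'r) \<times> ('b \<times> 'r)) set" where
  "loc_rel scl S = {((v, s), (w, t)). s \<in> S \<and> t \<in> S \<and>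
     (\<exists>u\<in>S. scl u (scl t v - scl s w) = 0)}"

definition loc_carrier ::
  "('r::comm_ring_1 \<Rightarrow> 'b::ab_group_add \<Rightarrow> 'b) \<Rightarrow> 'r set \<Rightarrow> ('b \<times> 'r) set set" where
  "loc_carrier scl S = (UNIV \<times> S) // loc_rel scl S"

definition loc_frac ::
  "('r::comm_ring_1 \<Rightarrow> 'b::ab_group_add \<Rightarrow> 'b) \<Rightarrow> 'r set \<Rightarrow> 'b \<Rightarrow> 'r \<Rightarrow> ('b \<times> 'r) set" where
  "loc_frac scl S v s = loc_rel scl S `` {(v, s)}"

text \<open>
  The unions below run over a family that is constant (see \<open>loc_add_frac\<close> and
  \<open>loc_smult_frac\<close>), so they denote the common value.
\<close>

definition loc_add ::
  "('r::comm_ring_1 \<Rightarrow> 'b::ab_group_add \<Rightarrow> 'b) \<Rightarrow> 'r set \<Rightarrow>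
     ('b \<times> 'r) set \<Rightarrow> ('b \<times> 'r) set \<Rightarrow> ('b \<times> 'r) set" where
  "loc_add scl S X Y =
     (\<Union>(v, s)\<in>X. \<Union>(w, t)\<in>Y. loc_frac scl S (scl t v + scl s w) (s * t))"

definition loc_smult ::
  "('r::comm_ring_1 \<Rightarrow> 'b::ab_group_add \<Rightarrow> 'b) \<Rightarrow> 'r set \<Rightarrow>
     'r \<Rightarrow> ('b \<times> 'r) set \<Rightarrow> ('b \<times> 'r) set" where
  "loc_smult scl S r X = (\<Union>(v, s)\<in>X. loc_frac scl S (scl r v) s)"

definition loc_map ::
  "('r::comm_ring_1 \<Rightarrow> 'b::ab_group_add \<Rightarrow> 'b) \<Rightarrow> 'r set \<Rightarrow> 'b \<Rightarrow> ('b \<times> 'r) set" where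
  "loc_map scl S v = loc_frac scl S v 1"

definition loc_kernel ::
  "('r::comm_ring_1 \<Rightarrow> 'b::ab_group_add \<Rightarrow> 'b) \<Rightarrow> 'r set \<Rightarrow> 'b set" where
  "loc_kernel scl S = {v. loc_map scl S v = loc_frac scl S 0 1}"

definition loc_section ::
  "('r::comm_ring_1 \<Rightarrow> 'b::ab_group_add \<Rightarrow> 'b) \<Rightarrow> 'r set \<Rightarrow> (('b \<times> 'r) set \<Rightarrow> 'b) \<Rightarrow> bool" where
  "loc_section scl S \<sigma> \<longleftrightarrow>
     (\<forall>X\<in>loc_carrier scl S. \<forall>Y\<in>loc_carrier scl S. \<sigma> (loc_add scl S X Y) = \<sigma> X + \<sigma> Y) \<and>
     (\<forall>r. \<forall>X\<in>loc_carrier scl S. \<sigma> (loc_smult scl S r X) = scl r (\<sigma> X)) \<and>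
     (\<forall>X\<in>loc_carrier scl S. loc_map scl S (\<sigma> X) = X)"

locale localization = module scl
  for scl :: "'r::comm_ring_1 \<Rightarrow> 'b::ab_group_add \<Rightarrow> 'b" +
  fixes S :: "'r set"
  assumes one_mem: "1 \<in> S" and mult_mem: "s \<in> S \<Longrightarrow> t \<in> S \<Longrightarrow> s * t \<in> S"
begin

lemma loc_relI:
  assumes "s \<in> S" "t \<in> S" "u \<in> S" "scl (u * t) v = scl (u * s) w"
  shows "((v, s), (w, t)) \<in> loc_rel scl S"
  using assms by (auto simp: loc_rel_def scale_right_diff_distrib intro!: bexI[of _ u])

lemma loc_relE:
  assumes "((v, s), (w, t)) \<in> loc_rel scl S"
  obtains u where "s \<in> S" "t \<in> S" "u \<in> S" "scl (u * t) v = scl (u * s) w"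
  using assms by (auto simp: loc_rel_def scale_right_diff_distrib)

lemma equiv_loc_rel: "equiv (UNIV \<times> S) (loc_rel scl S)"
proof (rule equivI)
  show "loc_rel scl S \<subseteq> (UNIV \<times> S) \<times> (UNIV \<times> S)"
    by (auto simp: loc_rel_def)
  show "refl_on (UNIV \<times> S) (loc_rel scl S)"
    by (auto simp: refl_on_def intro!: loc_relI[OF _ _ one_mem])
  show "sym (loc_rel scl S)"
    by (rule symI) (auto elim!: loc_relE intro: loc_relI)
  show "trans (loc_rel scl S)"
  proof (rule transI, clarify)
    fix v s w t z r
    assume "((v, s), (w, t)) \<in> loc_rel scl S" "((w, t), (z, r)) \<in> loc_rel scl S"
    then obtain a b where ab: "s \<in> S" "t \<in> S" "r \<in> S" "a \<in> S" "b \<in> S"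
      and a: "scl (a * t) v = scl (a * s) w" and b: "scl (b * r) w = scl (b * t) z"
      by (metis loc_relE)
    have "scl (a * b * t * r) v = scl (b * r) (scl (a * t) v)"
      by (simp add: mult_ac)
    also have "\<dots> = scl (a * s) (scl (b * r) w)"
      unfolding a by (simp add: mult_ac)
    also have "\<dots> = scl (a * b * t * s) z"
      unfolding b by (simp add: mult_ac)
    finally show "((v, s), (z, r)) \<in> loc_rel scl S"
      using ab by (intro loc_relI[of s r "a * b * t"]) (auto intro: mult_mem)
  qed
qed

lemma loc_frac_eqI: "((v, s), (w, t)) \<in> loc_rel scl S \<Longrightarrow> loc_frac scl S v s = loc_frac scl S w t"
  unfolding loc_frac_def by (rule equiv_class_eq[OF equiv_loc_rel])

lemma loc_frac_self: "s \<in> S \<Longrightarrow> (v, s) \<in> loc_frac scl S v s"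
  unfolding loc_frac_def by (rule equiv_class_self[OF equiv_loc_rel]) auto

lemma loc_smult_frac:
  assumes "s \<in> S"
  shows "loc_smult scl S r (loc_frac scl S v s) = loc_frac scl S (scl r v) s"
proof -
  have "loc_frac scl S (scl r w) t = loc_frac scl S (scl r v) s"
    if "(w, t) \<in> loc_frac scl S v s" for w t
  proof -
    from that obtain u where u: "s \<in> S" "t \<in> S" "u \<in> S" "scl (u * t) v = scl (u * s) w"
      unfolding loc_frac_def by (auto elim: loc_relE)
    have "scl (u * t) (scl r v) = scl r (scl (u * t) v)" by (simp add: mult_ac)
    also have "\<dots> = scl (u * s) (scl r w)" unfolding u(4) by (simp add: mult_ac)
    finally show ?thesis
      using u by (intro loc_frac_eqI[symmetric] loc_relI[of s t u])
  qed
  then show ?thesis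
    unfolding loc_smult_def using loc_frac_self[OF assms, of v] by fast
qed

lemma loc_add_frac:
  assumes "s \<in> S" "t \<in> S"
  shows "loc_add scl S (loc_frac scl S v s) (loc_frac scl S w t) =
    loc_frac scl S (scl t v + scl s w) (s * t)"
proof -
  have "loc_frac scl S (scl t' v' + scl s' w') (s' * t') =
      loc_frac scl S (scl t v + scl s w) (s * t)"
    if v': "(v', s') \<in> loc_frac scl S v s" and w': "(w', t') \<in> loc_frac scl S w t"
    for v' s' w' t'
  proof -
    from v' obtain a where a: "s' \<in> S" "a \<in> S" "scl (a * s') v = scl (a * s) v'"
      unfolding loc_frac_def by (auto elim: loc_relE)
    from w' obtain b where b: "t' \<in> S" "b \<in> S" "scl (b * t') w = scl (b * t) w'"
      unfolding loc_frac_def by (auto elim: loc_relE)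
    have "scl (a * b * (s' * t')) (scl t v + scl s w) =
        scl (b * t' * t) (scl (a * s') v) + scl (a * s' * s) (scl (b * t') w)"
      by (simp add: scale_right_distrib mult_ac)
    also have "\<dots> = scl (a * b * (s * t)) (scl t' v' + scl s' w')"
      unfolding a(3) b(3) by (simp add: scale_right_distrib mult_ac)
    finally show ?thesis
      using a b assms by (intro loc_frac_eqI[symmetric] loc_relI[of _ _ "a * b"]) (auto intro: mult_mem)
  qed
  then show ?thesis
    unfolding loc_add_def using loc_frac_self[OF assms(1), of v] loc_frac_self[OF assms(2), of w]
    by fast
qed

end

section \<open>The polynomial module structure defined by an endomorphism\<close>

definition poly_act ::
  "('a::field \<Rightarrow> 'b::ab_group_add \<Rightarrow> 'b) \<Rightarrow> ('b \<Rightarrow> 'b) \<Rightarrow> 'a poly \<Rightarrow> 'b \<Rightarrow> 'b" where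
  "poly_act scale f p v = (\<Sum>i\<le>degree p. scale (coeff p i) ((f ^^ i) v))"

definition X_powers :: "'a::field poly set" where
  "X_powers = range (\<lambda>n. [:0, 1:] ^ n)"

lemma poly_act_altdef:
  assumes "vector_space scale" "degree p \<le> N"
  shows "poly_act scale f p v = (\<Sum>i\<le>N. scale (coeff p i) ((f ^^ i) v))"
proof -
  interpret vector_space scale by fact
  show ?thesis unfolding poly_act_def
    using assms(2) by (intro sum.mono_neutral_left) (auto simp: coeff_eq_0)
qed

lemma poly_act_pCons:
  assumes "vector_space scale" "Vector_Spaces.linear scale scale f"
  shows "poly_act scale f (pCons a p) v = scale a v + f (poly_act scale f p v)"
proof -
  interpret vector_space scale by fact
  interpret l: Vector_Spaces.linear scale scale f by fact
  have "poly_act scale f (pCons a p) v =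
      (\<Sum>i\<le>Suc (degree p). scale (coeff (pCons a p) i) ((f ^^ i) v))"
    by (rule poly_act_altdef[OF assms(1)]) (auto simp: degree_pCons_le)
  also have "\<dots> = scale a v + (\<Sum>i\<le>degree p. scale (coeff p i) (f ((f ^^ i) v)))"
    by (subst sum.atMost_Suc_shift) simp
  also have "(\<Sum>i\<le>degree p. scale (coeff p i) (f ((f ^^ i) v))) = f (poly_act scale f p v)"
    by (simp add: poly_act_def l.sum l.scale)
  finally show ?thesis .
qed

lemma module_poly_act:
  assumes "vector_space scale" "Vector_Spaces.linear scale scale f"
  shows "module (poly_act scale f)"
proof -
  interpret vector_space scale by fact
  interpret l: Vector_Spaces.linear scale scale f by fact
  note pC = poly_act_pCons[OF assms]
  have zero: "poly_act scale f 0 v = 0" for v by (simp add: poly_act_def)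
  have addr: "poly_act scale f p (v + w) = poly_act scale f p v + poly_act scale f p w" for p v w
    by (induction p) (auto simp: zero pC l.add scale_right_distrib)
  have addl: "poly_act scale f (p + q) v = poly_act scale f p v + poly_act scale f q v" for p q v
    by (induction p q rule: poly_induct2) (auto simp: zero pC l.add scale_left_distrib)
  have smul: "poly_act scale f (smult a p) v = scale a (poly_act scale f p v)" for a p v
    by (induction p) (auto simp: zero pC l.scale scale_right_distrib)
  have mul: "poly_act scale f (p * q) v = poly_act scale f p (poly_act scale f q v)" for p q v
    by (induction p) (auto simp: zero pC addl smul)
  show ?thesis
    by unfold_locales (auto simp: addr addl mul one_pCons pC zero)
qed

lemma localization_X_powers:
  assumes "vector_space scale" "Vector_Spaces.linear scale scale f"
  shows "localization (poly_act scale f) X_powers"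
proof -
  interpret module "poly_act scale f" by (rule module_poly_act[OF assms])
  show ?thesis
    by unfold_locales (auto simp: X_powers_def intro: range_eqI[of _ _ 0] simp flip: power_add)
qed

end

theory Submission
  imports Defs
begin

text \<open>
  All five conditions say that for some \<open>m\<close> both chains
  \<open>Ker f \<subseteq> Ker f\<^sup>2 \<subseteq> \<dots>\<close> and \<open>Im f \<supseteq> Im f\<^sup>2 \<supseteq> \<dots>\<close> stop at step \<open>m\<close>, that is, that the
  index of \<open>f\<close> is finite. In infinite dimension neither stop implies the other, and both are needed
  for Fitting's decomposition \<open>V = Ker f\<^sup>m \<oplus> Im f\<^sup>m\<close> (\<open>decomposition_of_stable_at\<close>).

  Conversely, every decomposition \<open>V = U \<oplus> W\<close> of the required kind has \<open>U = Ker f\<^sup>n\<close> and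
  \<open>W = Im f\<^sup>n\<close> for all large \<open>n\<close> (\<open>decomposition_eventually\<close>). This gives its uniqueness and the
  stop of both chains at once. A core-nilpotent decomposition \<open>f = f\<^sub>1 + f\<^sub>2\<close> is the same
  datum: \<open>U = Ker f\<^sub>1\<close>, \<open>W = Im f\<^sub>1\<close>, and \<open>f\<^sub>1\<close> is \<open>f\<close> on \<open>W\<close> and zero on \<open>U\<close>.

  The remaining constructions go through the Drazin inverse \<open>d\<close>, which is the inverse of \<open>f\<close> on \<open>W\<close>
  and zero on \<open>U\<close>. If the chains stop at \<open>m\<close>, then \<open>d v\<close> is the only \<open>w \<in> Im f\<^sup>m\<close> with
  \<open>f\<^sup>m\<^sup>+\<^sup>1 w = f\<^sup>m v\<close> (\<open>drazin_inverse_exists\<close>), and its defining identities alone yield the rest: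
  \<open>f\<^sub>1 = f f d\<close> is the core part of \<open>f\<close>, and \<open>v / x\<^sup>n \<mapsto> d\<^sup>n\<^sup>+\<^sup>1 (f v)\<close> is a section of the
  localization map (\<open>section_exists\<close>).

  To come back from a section \<open>\<sigma>\<close>, note that the kernel \<open>K\<close> of the localization map is the
  union of all \<open>Ker f\<^sup>n\<close>, so nilpotency on \<open>K\<close> says that the kernels stop. The images stop because
  \<open>f (\<sigma> (v / x)) - v\<close> lies in \<open>K\<close>, and hence is killed by some fixed \<open>f\<^sup>N\<close>
  (\<open>stable_at_of_section\<close>).
\<close>

section \<open>Stabilization of kernels and images\<close>

definition stable_at :: "('b::zero \<Rightarrow> 'b) \<Rightarrow> nat \<Rightarrow> bool" where
  "stable_at f m \<longleftrightarrow> {v. (f ^^ m) v = 0} = {v. (f ^^ (m + 1)) v = 0} \<and>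
     range (f ^^ m) = range (f ^^ (m + 1))"

lemma endo_index_alt:
  "endo_index f = (if bij f then 0 else (INF m \<in> {m. 0 < m \<and> stable_at f m}. enat m))"
  by (simp add: endo_index_def stable_at_def)

locale endomorphism = Vector_Spaces.linear scale scale f
  for scale :: "'a::field \<Rightarrow> 'b::ab_group_add \<Rightarrow> 'b" and f :: "'b \<Rightarrow> 'b"
begin

lemma linear_funpow: "Vector_Spaces.linear scale scale (f ^^ n)"
proof (induction n)
  case 0
  show ?case using vs1.linear_id by (simp add: id_def)
next
  case (Suc n)
  show ?case
    unfolding funpow.simps by (rule Vector_Spaces.linear_compose[OF Suc linear_axioms])
qed

lemma pow_swap: "f ((f ^^ n) v) = (f ^^ n) (f v)"
  by (rule funpow_swap1)

lemma pow_plus: "(f ^^ (m + n)) v = (f ^^ m) ((f ^^ n) v)"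
  by (simp add: funpow_add)

lemma pow_add: "(f ^^ n) (v + w) = (f ^^ n) v + (f ^^ n) w"
  and pow_diff: "(f ^^ n) (v - w) = (f ^^ n) v - (f ^^ n) w"
  and pow_scale: "(f ^^ n) (scale c v) = scale c ((f ^^ n) v)"
  and pow_zero: "(f ^^ n) 0 = 0"
proof -
  interpret p: Vector_Spaces.linear scale scale "f ^^ n" by (rule linear_funpow)
  show "(f ^^ n) (v + w) = (f ^^ n) v + (f ^^ n) w"
    and "(f ^^ n) (v - w) = (f ^^ n) v - (f ^^ n) w"
    and "(f ^^ n) (scale c v) = scale c ((f ^^ n) v)"
    and "(f ^^ n) 0 = 0"
    by (rule p.add p.diff p.scale p.zero)+
qed

lemma bij_iff_stable_at_0: "bij f \<longleftrightarrow> stable_at f 0"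
proof
  assume b: "bij f"
  then have "f v = 0 \<longleftrightarrow> v = 0" for v
    using zero by (metis bij_is_inj injD)
  with b show "stable_at f 0"
    by (auto simp: stable_at_def bij_def)
next
  assume "stable_at f 0"
  then have ker: "\<And>v. f v = 0 \<Longrightarrow> v = 0" and "surj f"
    by (auto simp: stable_at_def set_eq_iff)
  moreover have "inj f"
    using ker by (auto intro!: injI simp: diff) (metis diff right_minus_eq)
  ultimately show "bij f" by (simp add: bij_def)
qed

lemma stable_at_ker:
  assumes "stable_at f m" and "(f ^^ (m + k)) v = 0"
  shows "(f ^^ m) v = 0"
  using assms(2)
proof (induction k)
  case (Suc k)
  have "(f ^^ (m + 1)) ((f ^^ k) v) = 0"
    using Suc.prems by (simp add: pow_swap funpow_add)
  then have "(f ^^ m) ((f ^^ k) v) = 0"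
    using assms(1) unfolding stable_at_def by blast
  then show ?case using Suc.IH by (simp add: funpow_add)
qed simp

lemma stable_at_range:
  assumes "stable_at f m"
  shows "(f ^^ m) v \<in> range (f ^^ (m + k))"
proof (induction k)
  case (Suc k)
  then obtain y where y: "(f ^^ m) v = (f ^^ k) ((f ^^ m) y)"
    by (metis add.commute comp_apply funpow_add imageE)
  obtain z where "(f ^^ m) y = (f ^^ (m + 1)) z"
    using assms unfolding stable_at_def by (metis imageE rangeI)
  then have "(f ^^ m) v = (f ^^ (k + (m + 1))) z"
    unfolding y by (simp add: funpow_add pow_swap)
  moreover have "k + (m + 1) = m + Suc k" by simp
  ultimately show ?case by (metis rangeI)
qed simp

lemma stable_at_Suc:
  assumes "stable_at f m"
  shows "stable_at f (m + 1)"
proof -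
  have "(f ^^ (m + 1)) v = 0 \<longleftrightarrow> (f ^^ (m + 1 + 1)) v = 0" for v
    using stable_at_ker[OF assms, of 2 v] by (auto simp: zero)
  moreover have "range (f ^^ (m + 1)) = range (f ^^ (m + 1 + 1))"
    using stable_at_range[OF assms, of _ 2] assms
    by (auto simp: stable_at_def pow_swap)
  ultimately show ?thesis by (simp add: stable_at_def)
qed

text \<open>
  An infimum of extended naturals that is finite is attained, so the index itself belongs to the set
  over which it is taken; index \<open>0\<close> is the case of an automorphism.
\<close>

lemma stable_at_endo_index:
  assumes "endo_index f = enat m"
  shows "stable_at f m"
proof (cases "bij f")
  case True
  then have "m = 0"
    using assms by (simp add: endo_index_def zero_enat_def)
  with True show ?thesis by (simp add: bij_iff_stable_at_0)
next
  case False
  let ?M = "{m. 0 < m \<and> stable_at f m}"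
  have eq: "(INF m \<in> ?M. enat m) = enat m"
    using assms False by (simp add: endo_index_alt)
  then have "?M \<noteq> {}" by (force simp: top_enat_def)
  then have ne: "enat ` ?M \<noteq> {}" by blast
  then obtain k where "k \<in> enat ` ?M" by blast
  then have "(INF m \<in> ?M. enat m) \<in> enat ` ?M"
    unfolding Inf_enat_def if_not_P[OF ne] by (rule LeastI)
  with eq show ?thesis by auto
qed

lemma endo_index_exists:
  assumes "stable_at f m"
  obtains n where "endo_index f = enat n"
proof -
  have "endo_index f \<le> enat (m + 1)"
  proof (cases "bij f")
    case True
    then show ?thesis by (simp add: endo_index_def)
  next
    case False
    then show ?thesis
      using stable_at_Suc[OF assms] by (auto simp: endo_index_alt intro!: INF_lower)
  qed
  then show ?thesis using that by (cases "endo_index f") auto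
qed

lemma endo_index_le_1_iff: "endo_index f \<le> 1 \<longleftrightarrow> stable_at f 1"
proof
  assume "endo_index f \<le> 1"
  then obtain n where n: "endo_index f = enat n" "n = 0 \<or> n = 1"
    by (cases "endo_index f") (auto simp: one_enat_def le_Suc_eq)
  then show "stable_at f 1"
    using stable_at_endo_index[OF n(1)] stable_at_Suc[of 0] by auto
next
  assume s: "stable_at f 1"
  show "endo_index f \<le> 1"
  proof (cases "bij f")
    case True
    then show ?thesis by (simp add: endo_index_def)
  next
    case False
    then show ?thesis
      using s by (auto simp: endo_index_alt one_enat_def intro!: INF_lower)
  qed
qed

end

section \<open>Fitting decompositions\<close>

context endomorphism
begin

text \<open>
  The splitting is the usual one: as \<open>f\<^sup>m v = f\<^sup>2\<^sup>m y\<close> for some \<open>y\<close>, write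
  \<open>v = (v - f\<^sup>m y) + f\<^sup>m y\<close>.
\<close>

lemma decomposition_of_stable_at:
  assumes "stable_at f m"
  shows "nilpotent_iso_decomposition scale f {v. (f ^^ m) v = 0} (range (f ^^ m))"
    (is "nilpotent_iso_decomposition scale f ?U ?W")
proof -
  interpret p: Vector_Spaces.linear scale scale "f ^^ m" by (rule linear_funpow)
  have U: "module.subspace scale ?U" by (rule p.subspace_kernel)
  have W: "module.subspace scale ?W" by (rule p.subspace_image[OF vs1.subspace_UNIV])
  have "w = 0" if w: "w \<in> ?U" "w \<in> ?W" for w
  proof -
    obtain y where "w = (f ^^ m) y" using w(2) by (rule imageE)
    then show ?thesis
      using stable_at_ker[OF assms, of m y] w(1) by (simp add: funpow_add)
  qed
  then have int: "?U \<inter> ?W = {0}"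
    using vs1.subspace_0[OF U] vs1.subspace_0[OF W] by blast
  have "v \<in> {u + w |u w. u \<in> ?U \<and> w \<in> ?W}" for v
  proof -
    obtain y where y: "(f ^^ m) v = (f ^^ m) ((f ^^ m) y)"
      using stable_at_range[OF assms, of v m] by (auto simp: funpow_add)
    have "v = (v - (f ^^ m) y) + (f ^^ m) y" by simp
    moreover have "v - (f ^^ m) y \<in> ?U" by (simp add: pow_diff y)
    ultimately show ?thesis by blast
  qed
  then have sum: "{u + w |u w. u \<in> ?U \<and> w \<in> ?W} = UNIV" by blast
  have fU: "f ` ?U \<subseteq> ?U"
    by (auto simp: pow_swap[symmetric] pow_zero zero)
  have fW: "f ` ?W = ?W"
  proof -
    have "f ` ?W = range (f ^^ (m + 1))" by (auto simp: image_image)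
    then show ?thesis using assms by (simp add: stable_at_def)
  qed
  have "inj_on f ?W"
  proof (rule inj_onI)
    fix a b assume ab: "a \<in> ?W" "b \<in> ?W" "f a = f b"
    then obtain y z where yz: "a = (f ^^ m) y" "b = (f ^^ m) z" by auto
    have "(f ^^ (m + 1)) (y - z) = 0"
      using ab(3) unfolding yz by (simp add: pow_diff diff)
    then have "(f ^^ m) (y - z) = 0" by (rule stable_at_ker[OF assms])
    then show "a = b" by (simp add: yz pow_diff)
  qed
  then have "bij_betw f ?W ?W" using fW by (simp add: bij_betw_def)
  moreover have "nilpotent_on f ?U" by (auto simp: nilpotent_on_def)
  ultimately show ?thesis
    unfolding nilpotent_iso_decomposition_def using U W int sum fU equalityD1[OF fW] by blast
qed

text \<open>
  If \<open>f\<^sup>n\<close> kills \<open>U\<close>, then on \<open>U \<oplus> W\<close> it only sees the component in \<open>W\<close>, on which it is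
  bijective; so its kernel is \<open>U\<close> and its image is \<open>W\<close>.
\<close>

lemma decomposition_eventually:
  assumes D: "nilpotent_iso_decomposition scale f U W"
  shows "\<exists>N. \<forall>n\<ge>N. U = {v. (f ^^ n) v = 0} \<and> W = range (f ^^ n)"
proof -
  have W: "module.subspace scale W"
    and sum: "{u + w |u w. u \<in> U \<and> w \<in> W} = UNIV" and bij: "bij_betw f W W"
    and nil: "nilpotent_on f U"
    using D by (simp_all add: nilpotent_iso_decomposition_def)
  have split: "\<exists>u w. v = u + w \<and> u \<in> U \<and> w \<in> W" for v
    using UNIV_I[of v] unfolding sum[symmetric] by (rule CollectD)
  obtain N where N: "\<And>u. u \<in> U \<Longrightarrow> (f ^^ N) u = 0"
    using nil unfolding nilpotent_on_def by blast
  have bijn: "bij_betw (f ^^ n) W W" for n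
    using bij by (rule bij_betw_funpow)
  show ?thesis
  proof (intro exI allI impI)
    fix n assume n: "N \<le> n"
    have 0: "(f ^^ n) u = 0" if "u \<in> U" for u
    proof -
      have "(f ^^ n) u = (f ^^ (n - N)) ((f ^^ N) u)"
        using n by (metis comp_apply funpow_add le_add_diff_inverse2)
      then show ?thesis using N[OF that] by (simp add: pow_zero)
    qed
    have "v \<in> U" if v: "(f ^^ n) v = 0" for v
    proof -
      obtain u w where uw: "v = u + w" "u \<in> U" "w \<in> W" using split[of v] by blast
      have "(f ^^ n) w = (f ^^ n) 0" using v 0[OF uw(2)] by (simp add: uw pow_add pow_zero)
      then have "w = 0"
        using bijn[of n] uw(3) vs1.subspace_0[OF W] by (meson bij_betw_def inj_onD)
      then show ?thesis using uw by simp
    qed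
    moreover have "(f ^^ n) v \<in> W" for v
    proof -
      obtain u w where uw: "v = u + w" "u \<in> U" "w \<in> W" using split[of v] by blast
      have "(f ^^ n) v = (f ^^ n) w" using 0[OF uw(2)] by (simp add: uw pow_add)
      then show ?thesis using bijn[of n] uw(3) by (metis bij_betwE)
    qed
    moreover have "W \<subseteq> range (f ^^ n)"
      using bij_betw_imp_surj_on[OF bijn[of n]] by blast
    ultimately have "U = {v. (f ^^ n) v = 0}" "W = range (f ^^ n)"
      using 0 by (blast intro: equalityI)+
    then show "U = {v. (f ^^ n) v = 0} \<and> W = range (f ^^ n)" ..
  qed
qed

lemma stable_at_of_decomposition:
  assumes "nilpotent_iso_decomposition scale f U W"
  obtains m where "stable_at f m"
proof -
  obtain N where N: "\<forall>n\<ge>N. U = {v. (f ^^ n) v = 0} \<and> W = range (f ^^ n)"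
    using decomposition_eventually[OF assms] by (rule exE)
  have "U = {v. (f ^^ N) v = 0}" "W = range (f ^^ N)"
    "U = {v. (f ^^ (N + 1)) v = 0}" "W = range (f ^^ (N + 1))"
    using N[rule_format, of N] N[rule_format, of "N + 1"] by (simp_all only: order_refl le_add1)
  then have "stable_at f N"
    unfolding stable_at_def by (iprover intro: conjI trans sym)
  then show ?thesis by (rule that)
qed

lemma decomposition_unique:
  assumes "nilpotent_iso_decomposition scale f U W" "nilpotent_iso_decomposition scale f U' W'"
  shows "U = U' \<and> W = W'"
proof -
  obtain N where N: "\<forall>n\<ge>N. U = {v. (f ^^ n) v = 0} \<and> W = range (f ^^ n)"
    using decomposition_eventually[OF assms(1)] by (rule exE)
  obtain N' where N': "\<forall>n\<ge>N'. U' = {v. (f ^^ n) v = 0} \<and> W' = range (f ^^ n)"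
    using decomposition_eventually[OF assms(2)] by (rule exE)
  show ?thesis
    using N[rule_format, of "max N N'"] N'[rule_format, of "max N N'"]
    by (simp only: max.cobounded1 max.cobounded2)
qed

end

section \<open>Core-nilpotent decompositions\<close>

context endomorphism
begin

text \<open>
  Index at most one means \<open>V = Ker f1 \<oplus> Im f1\<close> with \<open>f1\<close> bijective on its image. As \<open>f1\<close> and \<open>f2\<close>
  annihilate each other, \<open>f\<close> agrees with \<open>f2\<close> on \<open>Ker f1\<close> and with \<open>f1\<close> on \<open>Im f1\<close>.
\<close>

lemma decomposition_of_core_nilpotent:
  assumes C: "core_nilpotent_decomposition scale f f1 f2"
  shows "nilpotent_iso_decomposition scale f {v. f1 v = 0} (range f1)"
proof -
  have f: "f v = f1 v + f2 v" and f12: "f1 (f2 v) = 0" and f21: "f2 (f1 v) = 0" for v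
    using C by (auto simp: core_nilpotent_decomposition_def fun_eq_iff)
  interpret f1: endomorphism scale f1
    using C by (simp add: core_nilpotent_decomposition_def endomorphism_def)
  have "stable_at f1 1"
    using C f1.endo_index_le_1_iff by (simp add: core_nilpotent_decomposition_def)
  from f1.decomposition_of_stable_at[OF this]
  have D1: "nilpotent_iso_decomposition scale f1 {v. f1 v = 0} (range f1)" by simp
  have fU: "f u = f2 u" if "f1 u = 0" for u using that by (simp add: f)
  have fW: "f w = f1 w" if "w \<in> range f1" for w using that by (auto simp: f f21)
  obtain n where n: "\<And>v. (f2 ^^ n) v = 0"
    using C by (auto simp: core_nilpotent_decomposition_def nilpotent_on_def)
  have "(f ^^ k) u = (f2 ^^ k) u \<and> f1 ((f ^^ k) u) = 0" if "f1 u = 0" for k u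
    by (induction k) (auto simp: that fU f12)
  then have "nilpotent_on f {v. f1 v = 0}"
    by (auto simp: nilpotent_on_def n intro!: exI[of _ n])
  moreover have "bij_betw f (range f1) (range f1)"
    using D1 bij_betw_cong[of "range f1" f f1] fW
    by (simp add: nilpotent_iso_decomposition_def)
  moreover have "f ` {v. f1 v = 0} \<subseteq> {v. f1 v = 0}" by (auto simp: fU f12)
  moreover have "f ` range f1 \<subseteq> range f1" by (auto simp: fW)
  ultimately show ?thesis
    using D1 by (simp add: nilpotent_iso_decomposition_def)
qed

text \<open>
  The subspaces \<open>Ker f1\<close> and \<open>Im f1\<close> depend only on \<open>f\<close>, and they determine \<open>f1\<close>: it is zero on the
  first and equal to \<open>f\<close> on the second.
\<close>

lemma core_nilpotent_decomposition_unique: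
  assumes C: "core_nilpotent_decomposition scale f f1 f2"
    and C': "core_nilpotent_decomposition scale f g1 g2"
  shows "f1 = g1 \<and> f2 = g2"
proof -
  note D = decomposition_of_core_nilpotent[OF C] and D' = decomposition_of_core_nilpotent[OF C']
  have eq: "{v. f1 v = 0} = {v. g1 v = 0}" "range f1 = range g1"
    using decomposition_unique[OF D D'] by auto
  have f: "f v = f1 v + f2 v" "f v = g1 v + g2 v"
    and f21: "f2 (f1 v) = 0" "g2 (g1 v) = 0" for v
    using C C' by (auto simp: core_nilpotent_decomposition_def fun_eq_iff)
  interpret f1: endomorphism scale f1
    using C by (simp add: core_nilpotent_decomposition_def endomorphism_def)
  interpret g1: endomorphism scale g1
    using C' by (simp add: core_nilpotent_decomposition_def endomorphism_def)
  have 1: "f1 v = g1 v" for v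
  proof -
    have "v \<in> {u + w |u w. u \<in> {v. f1 v = 0} \<and> w \<in> range f1}"
      using D by (simp add: nilpotent_iso_decomposition_def)
    then obtain u w where uw: "v = u + w" "f1 u = 0" "w \<in> range f1" by auto
    have "g1 u = 0" "w \<in> range g1" using eq uw by auto
    have "f2 w = 0" "g2 w = 0"
      using f21(1) f21(2) uw(3) \<open>w \<in> range g1\<close> by (metis rangeE)+
    then have "f1 w = f w" "g1 w = f w"
      using f[of w] by simp_all
    then show ?thesis using uw \<open>g1 u = 0\<close> by (simp add: f1.add g1.add)
  qed
  moreover have "f2 v = g2 v" for v using f[of v] 1[of v] by simp
  ultimately show ?thesis by auto
qed

end

section \<open>Drazin inverses\<close>

locale drazin_pair = f: endomorphism scale f + d: endomorphism scale d
  for scale :: "'a::field \<Rightarrow> 'b::ab_group_add \<Rightarrow> 'b" and f d :: "'b \<Rightarrow> 'b" +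
  fixes m :: nat
  assumes dfd: "d (f (d v)) = d v" and commute: "d (f v) = f (d v)"
    and pow_Suc_d: "(f ^^ (m + 1)) (d v) = (f ^^ m) v"
begin

lemma pow_commute: "d ((f ^^ n) v) = (f ^^ n) (d v)"
  by (induction n) (auto simp: commute)

lemma dpow_commute: "(d ^^ k) (f v) = f ((d ^^ k) v)"
  by (induction k) (auto simp: commute)

lemma dpow_pow_commute: "(d ^^ k) ((f ^^ n) v) = (f ^^ n) ((d ^^ k) v)"
  by (induction n) (auto simp: dpow_commute)

text \<open>
  Since \<open>f d\<^sup>2 = d\<close>, each \<open>f\<close> cancels one \<open>d\<close> as long as at least one \<open>d\<close> is left. This is why the
  section below uses \<open>d\<^sup>n\<^sup>+\<^sup>1 (f v)\<close> instead of \<open>d\<^sup>n v\<close>: for \<open>n = 0\<close> the latter is \<open>v\<close>, whereas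
  the former is its component in \<open>Im f\<^sup>m\<close>.
\<close>

lemma absorb: "(f ^^ k) ((d ^^ (n + k + 1)) v) = (d ^^ (n + 1)) v"
proof (induction k)
  case (Suc k)
  have "(f ^^ Suc k) ((d ^^ (n + Suc k + 1)) v) = (f ^^ k) (f (d (d ((d ^^ (n + k)) v))))"
    by (simp add: f.pow_swap del: o_apply) (simp add: f.pow_swap)
  also have "f (d (d x)) = d x" for x using dfd commute by metis
  finally show ?case using Suc by simp
qed simp

lemma in_range: "d v \<in> range (f ^^ m)"
proof -
  have "d v = (f ^^ m) ((d ^^ (m + 1)) v)" using absorb[of m 0 v] by simp
  then show ?thesis by (rule range_eqI)
qed

lemma pow_m_shift: "(f ^^ (m + n)) ((d ^^ n) v) = (f ^^ m) v"
proof (induction n)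
  case (Suc n)
  have "m + Suc n = n + (m + 1)" by simp
  then have "(f ^^ (m + Suc n)) ((d ^^ Suc n) v) = (f ^^ n) ((f ^^ (m + 1)) (d ((d ^^ n) v)))"
    by (simp only: f.pow_plus funpow.simps o_apply)
  also have "\<dots> = (f ^^ (n + m)) ((d ^^ n) v)"
    unfolding pow_Suc_d by (rule f.pow_plus[symmetric])
  also have "\<dots> = (f ^^ (m + n)) ((d ^^ n) v)" by (simp only: add.commute)
  finally show ?case using Suc by simp
qed simp

text \<open>
  The map \<open>f d\<close> is the projection to \<open>Im f\<^sup>m\<close> along \<open>Ker f\<^sup>m\<close>, so the two summands are \<open>f\<close>
  composed with the two complementary projections.
\<close>

lemma core_nilpotent_decomposition:
  "core_nilpotent_decomposition scale f (\<lambda>v. f (f (d v))) (\<lambda>v. f v - f (f (d v)))"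
proof -
  define f1 where "f1 = (\<lambda>v. f (f (d v)))"
  define f2 where "f2 = (\<lambda>v. f v - f (f (d v)))"
  have f1: "f1 v = f (f (d v))" and f2: "f2 v = f v - f (f (d v))" for v
    by (simp_all add: f1_def f2_def)
  have ffd: "f (d (d v)) = d v" for v
    using dfd[of v] by (simp add: commute)
  interpret f1: endomorphism scale f1
    by unfold_locales (simp_all add: f1 f.add f.scale d.add d.scale)
  have lin2: "Vector_Spaces.linear scale scale f2"
    by unfold_locales
       (simp_all add: f2 f.add f.scale d.add d.scale f.vs1.scale_right_diff_distrib)
  have f1_sq_d: "f1 v = f1 (f1 (d v))" and d_f1_sq: "f1 v = d (f1 (f1 v))" for v
    by (simp_all add: f1 commute ffd)
  have "f1 (f1 v) = 0 \<longleftrightarrow> f1 v = 0" for v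
    using d_f1_sq[of v] by (auto simp: d.zero f1.zero)
  moreover have "range f1 = range (\<lambda>v. f1 (f1 v))"
  proof
    show "range f1 \<subseteq> range (\<lambda>v. f1 (f1 v))"
      using f1_sq_d by (intro image_subsetI range_eqI)
  qed auto
  ultimately have "stable_at f1 1" by (simp add: stable_at_def o_def)
  then have idx: "endo_index f1 \<le> 1" by (simp add: f1.endo_index_le_1_iff)
  have f12: "f1 (f2 v) = 0" and f21: "f2 (f1 v) = 0" for v
    by (simp_all add: f1 f2 f.diff d.diff commute ffd)
  have comm: "f2 ((f ^^ n) v) = (f ^^ n) (f2 v)" for n v
    by (simp add: f2 f.pow_diff pow_commute f.pow_swap)
  have sq2: "f2 (f2 v) = f (f2 v)" for v
    using f12[of v] unfolding f1 by (simp add: f2[of "f2 v"])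
  \<comment> \<open>One factor \<open>f2\<close> has to remain: \<open>f2\<close> agrees with \<open>f\<close> only on the image of \<open>f2\<close>.\<close>
  have pow: "(f2 ^^ (n + 1)) v = (f ^^ n) (f2 v)" for n v
    by (induction n) (simp_all add: comm sq2 f.pow_swap)
  have "(f ^^ m) (f2 v) = 0" for v
    using pow_Suc_d[of "f v"] by (simp add: f2 f.pow_diff f.pow_swap commute)
  then have "nilpotent_on f2 UNIV"
    unfolding nilpotent_on_def pow[symmetric] by blast
  moreover have "f = (\<lambda>v. f1 v + f2 v)" by (simp add: f1 f2)
  ultimately have "core_nilpotent_decomposition scale f f1 f2"
    using f1.linear_axioms lin2 idx f12 f21
    by (simp add: core_nilpotent_decomposition_def o_def)
  then show ?thesis unfolding f1_def f2_def .
qed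

end

context endomorphism
begin

lemma drazin_inverse_pair:
  assumes "drazin_inverse scale f d" and m: "endo_index f = enat m"
  shows "drazin_pair scale f d m"
proof -
  interpret d: endomorphism scale d
    using assms by (simp add: drazin_inverse_def endomorphism_def)
  show ?thesis
    using assms by unfold_locales (auto simp: drazin_inverse_def fun_eq_iff)
qed

text \<open>
  The equation \<open>f\<^sup>m\<^sup>+\<^sup>1 w = f\<^sup>m v\<close> has at most one solution in \<open>Im f\<^sup>m\<close>, because \<open>f\<close> is injective
  there. A Drazin inverse solves it for every \<open>v\<close>, which makes it unique.
\<close>

lemma drazin_equation_unique:
  assumes "stable_at f m" "w \<in> range (f ^^ m)" "w' \<in> range (f ^^ m)"
    "(f ^^ (m + 1)) w = (f ^^ (m + 1)) w'"
  shows "w = w'"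
proof -
  obtain y z where yz: "w = (f ^^ m) y" "w' = (f ^^ m) z" using assms by auto
  have "(f ^^ (m + 1)) ((f ^^ m) (y - z)) = 0"
    using assms(4) by (simp add: yz pow_diff diff)
  then have "(f ^^ (m + (m + 1))) (y - z) = 0"
    by (metis add.commute comp_apply funpow_add)
  then have "(f ^^ m) (y - z) = 0" by (rule stable_at_ker[OF assms(1)])
  then show ?thesis by (simp add: yz pow_diff)
qed

lemma drazin_inverse_unique:
  assumes "drazin_inverse scale f d" "drazin_inverse scale f d'"
  shows "d = d'"
proof
  fix v
  obtain m where m: "endo_index f = enat m"
    using assms by (auto simp: drazin_inverse_def)
  interpret d: drazin_pair scale f d m by (rule drazin_inverse_pair[OF assms(1) m])
  interpret d': drazin_pair scale f d' m by (rule drazin_inverse_pair[OF assms(2) m])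
  show "d v = d' v"
    using stable_at_endo_index[OF m] d.in_range d'.in_range
    by (rule drazin_equation_unique) (metis d.pow_Suc_d d'.pow_Suc_d)
qed

text \<open>
  Linearity and the Drazin identities all follow from the unique solvability of
  \<open>f\<^sup>m\<^sup>+\<^sup>1 w = f\<^sup>m v\<close> in \<open>Im f\<^sup>m\<close>: in each case both sides solve the same equation.
\<close>

lemma drazin_inverse_exists:
  assumes "stable_at f k"
  obtains d where "drazin_inverse scale f d"
proof -
  obtain m where m: "endo_index f = enat m" using endo_index_exists[OF assms] .
  have s: "stable_at f m" by (rule stable_at_endo_index[OF m])
  have "\<forall>v. \<exists>w. w \<in> range (f ^^ m) \<and> (f ^^ (m + 1)) w = (f ^^ m) v"
  proof
    fix v
    obtain z where "(f ^^ m) v = (f ^^ (m + (m + 1))) z"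
      using stable_at_range[OF s] by (rule imageE)
    also have "\<dots> = (f ^^ (m + 1)) ((f ^^ m) z)"
      by (simp only: add.commute[of m] pow_plus)
    finally show "\<exists>w. w \<in> range (f ^^ m) \<and> (f ^^ (m + 1)) w = (f ^^ m) v"
      by (metis rangeI)
  qed
  then obtain d where d: "\<forall>v. d v \<in> range (f ^^ m) \<and> (f ^^ (m + 1)) (d v) = (f ^^ m) v"
    by (rule choice[THEN exE])
  then have ran: "d v \<in> range (f ^^ m)" and eq: "(f ^^ (m + 1)) (d v) = (f ^^ m) v" for v
    by blast+
  have char: "w = d v" if "w \<in> range (f ^^ m)" "(f ^^ (m + 1)) w = (f ^^ m) v" for v w
    using drazin_equation_unique[OF s that(1) ran] that(2) eq by simp
  have W: "module.subspace scale (range (f ^^ m))" and fW: "f ` range (f ^^ m) \<subseteq> range (f ^^ m)"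
    using decomposition_of_stable_at[OF s] by (auto simp: nilpotent_iso_decomposition_def)
  have "d v + d w = d (v + w)" for v w
    using W ran eq by (intro char vs1.subspace_add) (simp_all only: pow_add)
  moreover have "scale c (d v) = d (scale c v)" for c v
    using W ran eq by (intro char vs1.subspace_scale) (simp_all only: pow_scale)
  ultimately have "Vector_Spaces.linear scale scale d"
    by unfold_locales simp_all
  moreover have com: "f (d v) = d (f v)" for v
    using fW ran eq[of v] by (intro char) (auto simp: pow_swap)
  moreover have "d v = d (f (d v))" for v
    using ran by (intro char) (simp_all add: pow_swap)
  ultimately have "drazin_inverse scale f d"
    using m eq by (auto simp: drazin_inverse_def fun_eq_iff)
  then show ?thesis by (rule that)
qed

end

section \<open>Sections of the localization map\<close>

context endomorphism
begin

sublocale act: module "poly_act scale f"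
  by (rule module_poly_act[OF vs1.vector_space_axioms linear_axioms])

sublocale loc: localization "poly_act scale f" X_powers
  by (rule localization_X_powers[OF vs1.vector_space_axioms linear_axioms])

lemma poly_act_X_power: "poly_act scale f ([:0, 1:] ^ n) v = (f ^^ n) v"
proof (induction n)
  case (Suc n)
  have "poly_act scale f ([:0, 1:] ^ Suc n) v = poly_act scale f [:0, 1:] ((f ^^ n) v)"
    by (simp only: power_Suc act.scale_scale[symmetric] Suc)
  also have "\<dots> = f ((f ^^ n) v)"
    by (simp add: poly_act_def zero)
  finally show ?case by simp
qed simp

abbreviation frac :: "'b \<Rightarrow> nat \<Rightarrow> ('b \<times> 'a poly) set" where
  "frac v n \<equiv> loc_frac (poly_act scale f) X_powers v ([:0, 1:] ^ n)"

lemma X_power_mem: "[:0, 1:] ^ n \<in> X_powers"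
  by (simp add: X_powers_def)

lemma loc_rel_iff:
  "((v, [:0, 1:] ^ n), (w, [:0, 1:] ^ k)) \<in> loc_rel (poly_act scale f) X_powers \<longleftrightarrow>
     (\<exists>j. (f ^^ (j + k)) v = (f ^^ (j + n)) w)"
proof -
  have "((v, [:0, 1:] ^ n), (w, [:0, 1:] ^ k)) \<in> loc_rel (poly_act scale f) X_powers \<longleftrightarrow>
      (\<exists>j. (f ^^ j) ((f ^^ k) v - (f ^^ n) w) = 0)"
    using X_power_mem by (auto simp: loc_rel_def X_powers_def poly_act_X_power)
  then show ?thesis by (simp add: pow_diff funpow_add)
qed

lemma frac_eq_iff: "frac v n = frac w k \<longleftrightarrow> (\<exists>j. (f ^^ (j + k)) v = (f ^^ (j + n)) w)"
  unfolding loc_rel_iff[symmetric] loc_frac_def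
  by (rule eq_equiv_class_iff[OF loc.equiv_loc_rel]) (simp_all add: X_power_mem)

lemma carrier_cases:
  assumes "z \<in> loc_carrier (poly_act scale f) X_powers"
  obtains v n where "z = frac v n"
  using assms by (auto simp: loc_carrier_def quotient_def loc_frac_def X_powers_def)

lemma frac_mem: "frac v n \<in> loc_carrier (poly_act scale f) X_powers"
  using X_power_mem by (auto simp: loc_carrier_def loc_frac_def intro!: quotientI)

lemma frac_memE:
  assumes "(w, t) \<in> frac v n"
  obtains k where "t = [:0, 1:] ^ k" "frac w k = frac v n"
proof -
  have "((v, [:0, 1:] ^ n), (w, t)) \<in> loc_rel (poly_act scale f) X_powers"
    using assms by (simp add: loc_frac_def)
  moreover from this obtain k where "t = [:0, 1:] ^ k"
    by (auto simp: loc_rel_def X_powers_def)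
  ultimately show ?thesis using that loc.loc_frac_eqI by metis
qed

lemma loc_map_eq: "loc_map (poly_act scale f) X_powers v = frac v 0"
  by (simp add: loc_map_def)

lemma loc_kernel_iff:
  "v \<in> loc_kernel (poly_act scale f) X_powers \<longleftrightarrow> (\<exists>n. (f ^^ n) v = 0)"
  using frac_eq_iff[of v 0 0 0] by (simp add: loc_kernel_def loc_map_eq pow_zero)

lemma smult_frac:
  "loc_smult (poly_act scale f) X_powers p (frac v n) = frac (poly_act scale f p v) n"
  by (rule loc.loc_smult_frac[OF X_power_mem])

lemma add_frac:
  "loc_add (poly_act scale f) X_powers (frac v n) (frac w k) =
     frac ((f ^^ k) v + (f ^^ n) w) (n + k)"
  using loc.loc_add_frac[OF X_power_mem X_power_mem, of v n w k]
  by (simp add: poly_act_X_power power_add)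

lemma diff_mem_loc_kernel:
  assumes "loc_map (poly_act scale f) X_powers v = loc_map (poly_act scale f) X_powers w"
  shows "v - w \<in> loc_kernel (poly_act scale f) X_powers"
  using assms frac_eq_iff[of v 0 w 0] unfolding loc_map_eq loc_kernel_iff
  by (simp add: pow_diff)

lemma loc_kernel_nilpotentE:
  assumes "nilpotent_on f (loc_kernel (poly_act scale f) X_powers)"
  obtains N where "\<forall>v. v \<in> loc_kernel (poly_act scale f) X_powers \<longleftrightarrow> (f ^^ N) v = 0"
  using assms unfolding nilpotent_on_def by (metis loc_kernel_iff)

text \<open>
  The section supplies \<open>w = \<sigma> (v / x)\<close>, a division of \<open>v\<close> by \<open>x\<close> up to the kernel. If \<open>w / 1 = v / x\<close>, then
  \<open>f w / 1 = v / 1\<close>, so \<open>f w\<close> and \<open>v\<close> differ by an element of the kernel, and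
  \<open>f\<^sup>N v = f\<^sup>N\<^sup>+\<^sup>1 w\<close>.
\<close>

lemma stable_at_of_section:
  assumes \<sigma>: "loc_section (poly_act scale f) X_powers \<sigma>"
    and nil: "nilpotent_on f (loc_kernel (poly_act scale f) X_powers)"
  obtains m where "stable_at f m"
proof -
  obtain N where N: "\<forall>v. v \<in> loc_kernel (poly_act scale f) X_powers \<longleftrightarrow> (f ^^ N) v = 0"
    using loc_kernel_nilpotentE[OF nil] .
  have ker: "(f ^^ N) v = 0 \<longleftrightarrow> (f ^^ (N + 1)) v = 0" for v
  proof
    assume "(f ^^ (N + 1)) v = 0"
    then have "v \<in> loc_kernel (poly_act scale f) X_powers" unfolding loc_kernel_iff by (rule exI)
    with N show "(f ^^ N) v = 0" by blast
  qed (simp add: zero)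
  have ran: "(f ^^ N) v \<in> range (f ^^ (N + 1))" for v
  proof -
    define w where "w = \<sigma> (frac v 1)"
    have "frac w 0 = frac v 1"
      using \<sigma> frac_mem unfolding loc_section_def loc_map_eq w_def by blast
    then obtain j where "(f ^^ (j + 1)) w = (f ^^ (j + 0)) v"
      unfolding frac_eq_iff by (rule exE)
    then have "(f ^^ (j + 0)) (f w) = (f ^^ (j + 0)) v"
      by (simp add: pow_swap)
    then have "frac (f w) 0 = frac v 0"
      unfolding frac_eq_iff by (rule exI)
    then have "f w - v \<in> loc_kernel (poly_act scale f) X_powers"
      by (intro diff_mem_loc_kernel) (simp add: loc_map_eq)
    then have "(f ^^ N) v = (f ^^ (N + 1)) w"
      by (simp add: N pow_diff pow_swap)
    then show ?thesis by (metis rangeI)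
  qed
  have "range (f ^^ (N + 1)) \<subseteq> range (f ^^ N)"
    by (auto simp: pow_swap)
  with ker ran have "stable_at f N" by (auto simp: stable_at_def)
  then show ?thesis by (rule that)
qed

text \<open>
  Two sections differ by values in the kernel, on which \<open>x\<^sup>N\<close> acts as zero. But every element of the
  localization is divisible by \<open>x\<^sup>N\<close>, so the difference vanishes.
\<close>

lemma section_unique:
  assumes nil: "nilpotent_on f (loc_kernel (poly_act scale f) X_powers)"
    and \<sigma>: "loc_section (poly_act scale f) X_powers \<sigma>"
    and \<sigma>': "loc_section (poly_act scale f) X_powers \<sigma>'"
    and z: "z \<in> loc_carrier (poly_act scale f) X_powers"
  shows "\<sigma> z = \<sigma>' z"
proof -
  obtain N where N: "\<forall>v. v \<in> loc_kernel (poly_act scale f) X_powers \<longleftrightarrow> (f ^^ N) v = 0"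
    using loc_kernel_nilpotentE[OF nil] .
  obtain v n where v: "z = frac v n" using carrier_cases[OF z] .
  define z' where "z' = frac v (n + N)"
  have z': "z' \<in> loc_carrier (poly_act scale f) X_powers"
    unfolding z'_def by (rule frac_mem)
  have "frac ((f ^^ N) v) (n + N) = frac v n"
    unfolding frac_eq_iff by (intro exI[of _ 0]) (simp add: funpow_add)
  then have "z = loc_smult (poly_act scale f) X_powers ([:0, 1:] ^ N) z'"
    by (simp add: v z'_def smult_frac poly_act_X_power)
  then have pow: "\<sigma> z = (f ^^ N) (\<sigma> z')" "\<sigma>' z = (f ^^ N) (\<sigma>' z')"
    using \<sigma> \<sigma>' z' by (simp_all add: loc_section_def poly_act_X_power)
  have "\<sigma> z' - \<sigma>' z' \<in> loc_kernel (poly_act scale f) X_powers"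
    using \<sigma> \<sigma>' z' by (intro diff_mem_loc_kernel) (simp add: loc_section_def)
  then show ?thesis by (simp add: N pow pow_diff)
qed

end

context drazin_pair
begin

lemma poly_act_commute: "d (poly_act scale f p v) = poly_act scale f p (d v)"
  by (simp add: poly_act_def d.sum d.scale pow_commute)

lemma poly_act_dpow_commute: "(d ^^ n) (poly_act scale f p v) = poly_act scale f p ((d ^^ n) v)"
  by (induction n) (simp_all add: poly_act_commute)

lemma section_well_defined:
  assumes "f.frac v n = f.frac w k"
  shows "(d ^^ (n + 1)) (f v) = (d ^^ (k + 1)) (f w)"
proof -
  obtain j where j: "(f ^^ (j + k)) v = (f ^^ (j + n)) w"
    using assms unfolding f.frac_eq_iff by blast
  have "(d ^^ (n + 1)) (f v) = (f ^^ (j + k)) ((d ^^ (n + (j + k) + 1)) (f v))"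
    by (rule absorb[symmetric])
  also have "\<dots> = (d ^^ (n + (j + k) + 1)) (f ((f ^^ (j + k)) v))"
    unfolding dpow_pow_commute[symmetric] by (simp add: f.pow_swap)
  also have "\<dots> = (d ^^ (k + (j + n) + 1)) (f ((f ^^ (j + n)) w))"
    unfolding j by (simp add: add_ac)
  also have "\<dots> = (f ^^ (j + n)) ((d ^^ (k + (j + n) + 1)) (f w))"
    unfolding dpow_pow_commute[symmetric] by (simp add: f.pow_swap)
  also have "\<dots> = (d ^^ (k + 1)) (f w)"
    by (rule absorb)
  finally show ?thesis .
qed

text \<open>
  The section sends \<open>v / x\<^sup>n\<close> to \<open>d\<^sup>n\<^sup>+\<^sup>1 (f v)\<close>: the projection of \<open>v\<close> to the summand on which \<open>f\<close>
  is invertible, followed by the \<open>n\<close>-th power of the inverse.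
\<close>

lemma section_exists:
  obtains \<sigma> where "loc_section (poly_act scale f) X_powers \<sigma>"
proof -
  \<comment> \<open>The exponent of a denominator \<open>x\<^sup>n\<close> is recovered as its degree.\<close>
  define \<sigma> where "\<sigma> X = (let (v, s) = SOME p. p \<in> X in (d ^^ (degree s + 1)) (f v))"
    for X :: "('b \<times> 'a poly) set"
  have \<sigma>: "\<sigma> (f.frac v n) = (d ^^ (n + 1)) (f v)" for v n
  proof -
    obtain w t where wt: "(SOME p. p \<in> f.frac v n) = (w, t)" by fastforce
    have "(v, [:0, 1:] ^ n) \<in> f.frac v n"
      by (rule f.loc.loc_frac_self[OF f.X_power_mem])
    then have "(w, t) \<in> f.frac v n" unfolding wt[symmetric] by (rule someI)
    then obtain k where k: "t = [:0, 1:] ^ k" "f.frac w k = f.frac v n"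
      by (rule f.frac_memE)
    have "degree t = k" by (simp add: k degree_power_eq)
    then show ?thesis
      using section_well_defined[OF k(2)] by (simp add: \<sigma>_def wt del: funpow.simps)
  qed
  have "\<sigma> (loc_add (poly_act scale f) X_powers X Y) = \<sigma> X + \<sigma> Y"
    if XY: "X \<in> loc_carrier (poly_act scale f) X_powers" "Y \<in> loc_carrier (poly_act scale f) X_powers"
    for X Y
  proof -
    obtain v n w k where X: "X = f.frac v n" and Y: "Y = f.frac w k"
      using XY by (metis f.carrier_cases)
    have "\<sigma> (loc_add (poly_act scale f) X_powers X Y) =
        (d ^^ (n + k + 1)) (f ((f ^^ k) v)) + (d ^^ (n + k + 1)) (f ((f ^^ n) w))"
      unfolding X Y f.add_frac \<sigma> f.add d.pow_add ..
    also have "(d ^^ (n + k + 1)) (f ((f ^^ k) v)) = \<sigma> X"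
      unfolding X \<sigma> absorb[of k n, symmetric] dpow_pow_commute[symmetric]
      by (simp add: f.pow_swap)
    also have "(d ^^ (n + k + 1)) (f ((f ^^ n) w)) = \<sigma> Y"
      unfolding Y \<sigma> absorb[of n k, symmetric] dpow_pow_commute[symmetric]
      by (simp add: f.pow_swap add_ac)
    finally show ?thesis .
  qed
  moreover have "\<sigma> (loc_smult (poly_act scale f) X_powers p X) = poly_act scale f p (\<sigma> X)"
    if X: "X \<in> loc_carrier (poly_act scale f) X_powers" for p X
  proof -
    obtain v n where X: "X = f.frac v n" using f.carrier_cases[OF X] .
    have "f (poly_act scale f p v) = poly_act scale f p (f v)"
      by (simp add: poly_act_def f.sum f.scale f.pow_swap)
    then show ?thesis
      unfolding X f.smult_frac \<sigma> poly_act_dpow_commute[symmetric] by simp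
  qed
  moreover have "loc_map (poly_act scale f) X_powers (\<sigma> X) = X"
    if X: "X \<in> loc_carrier (poly_act scale f) X_powers" for X
  proof -
    obtain v n where X: "X = f.frac v n" using f.carrier_cases[OF X] .
    have "(f ^^ (m + n)) ((d ^^ (n + 1)) (f v)) = (f ^^ (m + (n + 1))) ((d ^^ (n + 1)) v)"
      unfolding dpow_commute by (simp add: f.pow_swap)
    also have "\<dots> = (f ^^ m) v" by (rule pow_m_shift)
    finally have "f.frac ((d ^^ (n + 1)) (f v)) 0 = f.frac v n"
      unfolding f.frac_eq_iff by (intro exI[of _ m]) simp
    then show ?thesis unfolding X \<sigma> f.loc_map_eq .
  qed
  ultimately have "loc_section (poly_act scale f) X_powers \<sigma>"
    by (simp add: loc_section_def)
  then show ?thesis by (rule that)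
qed

lemma nilpotent_on_loc_kernel: "nilpotent_on f (loc_kernel (poly_act scale f) X_powers)"
proof -
  have "(f ^^ m) v = 0" if "(f ^^ n) v = 0" for v n
    using pow_m_shift[of n v] dpow_pow_commute[of n n v] that
    by (simp add: funpow_add d.pow_zero f.pow_zero)
  then have "\<forall>v \<in> loc_kernel (poly_act scale f) X_powers. (f ^^ m) v = 0"
    unfolding f.loc_kernel_iff Ball_def by blast
  then show ?thesis unfolding nilpotent_on_def ..
qed

end

section \<open>The equivalences\<close>

theorem theorem5p4:
  fixes scale :: "'a::field \<Rightarrow> 'b::ab_group_add \<Rightarrow> 'b" and f :: "'b \<Rightarrow> 'b"
  assumes "vector_space scale" and "Vector_Spaces.linear scale scale f"
  shows
    "(core_nilpotent scale f \<longleftrightarrow>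
        (\<exists>\<sigma>. loc_section (poly_act scale f) X_powers \<sigma>) \<and>
        nilpotent_on f (loc_kernel (poly_act scale f) X_powers)) \<and>
     (core_nilpotent scale f \<longleftrightarrow> (\<exists>U W. nilpotent_iso_decomposition scale f U W)) \<and>
     (core_nilpotent scale f \<longleftrightarrow> (\<exists>f1 f2. core_nilpotent_decomposition scale f f1 f2)) \<and>
     (core_nilpotent scale f \<longleftrightarrow> (\<exists>d. drazin_inverse scale f d)) \<and>
     (nilpotent_on f (loc_kernel (poly_act scale f) X_powers) \<longrightarrow>
        (\<forall>\<sigma> \<sigma>'. loc_section (poly_act scale f) X_powers \<sigma> \<and>
                loc_section (poly_act scale f) X_powers \<sigma>' \<longrightarrow>
                (\<forall>z\<in>loc_carrier (poly_act scale f) X_powers. \<sigma> z = \<sigma>' z))) \<and>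
     (\<forall>U W U' W'. nilpotent_iso_decomposition scale f U W \<and>
                   nilpotent_iso_decomposition scale f U' W' \<longrightarrow> U = U' \<and> W = W') \<and>
     (\<forall>f1 f2 g1 g2. core_nilpotent_decomposition scale f f1 f2 \<and>
                     core_nilpotent_decomposition scale f g1 g2 \<longrightarrow> f1 = g1 \<and> f2 = g2) \<and>
     (\<forall>d d'. drazin_inverse scale f d \<and> drazin_inverse scale f d' \<longrightarrow> d = d')"
proof -
  interpret endomorphism scale f
    using assms by (simp add: endomorphism_def)
  let ?I = "core_nilpotent scale f"
  let ?II = "(\<exists>\<sigma>. loc_section (poly_act scale f) X_powers \<sigma>) \<and>
    nilpotent_on f (loc_kernel (poly_act scale f) X_powers)"
  let ?III = "\<exists>U W. nilpotent_iso_decomposition scale f U W"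
  let ?V = "\<exists>d. drazin_inverse scale f d"
  have I_III: ?III if ?I
    using that decomposition_of_core_nilpotent unfolding core_nilpotent_def by blast
  have III_V: ?V if ?III
  proof -
    from that obtain U W where "nilpotent_iso_decomposition scale f U W" by blast
    then obtain m where "stable_at f m" by (rule stable_at_of_decomposition)
    then obtain d where "drazin_inverse scale f d" by (rule drazin_inverse_exists)
    then show ?V by blast
  qed
  have V_I_II: "?I \<and> ?II" if ?V
  proof -
    from that obtain d m where "drazin_inverse scale f d" "endo_index f = enat m"
      unfolding drazin_inverse_def by blast
    then interpret drazin_pair scale f d m by (rule drazin_inverse_pair)
    obtain \<sigma> where "loc_section (poly_act scale f) X_powers \<sigma>" by (rule section_exists)
    with core_nilpotent_decomposition nilpotent_on_loc_kernel show ?thesis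
      unfolding core_nilpotent_def by blast
  qed
  have II_V: ?V if ?II
  proof -
    from that obtain \<sigma> where "loc_section (poly_act scale f) X_powers \<sigma>"
      and "nilpotent_on f (loc_kernel (poly_act scale f) X_powers)" by blast
    then obtain m where "stable_at f m" by (rule stable_at_of_section)
    then obtain d where "drazin_inverse scale f d" by (rule drazin_inverse_exists)
    then show ?V by blast
  qed
  have equiv: "?I \<longleftrightarrow> ?II" "?I \<longleftrightarrow> ?III" "?I \<longleftrightarrow> ?V"
    using I_III III_V V_I_II II_V by argo+
  note unique = section_unique decomposition_unique core_nilpotent_decomposition_unique
    drazin_inverse_unique
  show ?thesis
    by (intro conjI; (rule equiv core_nilpotent_def |
          (intro allI impI ballI; elim conjE; rule unique; assumption)))
qed

end
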